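(* Let $a,b,c$ be real numbers with $a\neq 0$, $c>0$ and $b^2-4c<0$. Let $\phi\in(0,\pi)$ be defined by $\frac{1}{2\sqrt c}\left[b\pm \mathrm{i}\sqrt{4c-b^2}\right]=e^{\pm\mathrm{i}\phi}$. Then for all $n\ge 1$, $$\Psi_n(x;a,b,c)=(n-1)!\,c^{\frac{n-1}{2}}\,a\,x\,P_{n-1}^{(1)}\left(\frac{a}{\sqrt{4c-b^2}}x;\phi\right).$$
   Context: The polynomials $\Psi_n(x;a,b,c)$ are defined by the generating function $\exp[xf(z)]=\sum_{n=0}^\infty\Psi_n(x;a,b,c)\frac{z^n}{n!}$ with $$f(z)=\frac{a}{\sqrt{b^2-4c}}\ln\left[\frac{1-zR^-}{1-zR^+}\right],\qquad R^\pm=\frac12\left[b\pm\sqrt{b^2-4c}\right],$$ where $\sqrt{b^2-4c}=\mathrm{i}\sqrt{4c-b^2}$ and the branch of the logarithm vanishes at $z=0$. The Meixner–Pollaczek polynomials $P_n^{(\lambda)}(x;\phi)$ ($\lambda>0$, $0<\phi<\pi$) are $$P_n^{(\lambda)}(x;\phi)=\frac{(2\lambda)_n}{n!}e^{\mathrm{i}n\phi}\,{}_2F_1\left(-n,\lambda+\mathrm{i}x;2\lambda;1-e^{-2\mathrm{i}\phi}\right),$$ with generating function $\left(1-ze^{\mathrm{i}\phi}\right)^{-\lambda+\mathrm{i}x}\left(1-ze^{-\mathrm{i}\phi}\right)^{-\lambda-\mathrm{i}x}=\sum_{n\ge0}P_n^{(\lambda)}(x;\phi)z^n$. *)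

theory Defs
  imports "HOL-Complex_Analysis.Complex_Analysis"
begin

(* Since csqrt (-r) = \<i> * sqrt r for real r \<ge> 0, the convention
   sqrt (b^2 - 4c) = \<i> sqrt (4c - b^2) is the principal branch csqrt. *)
definition sqrt_disc :: "real \<Rightarrow> real \<Rightarrow> complex" where
  "sqrt_disc b c = csqrt (of_real (b\<^sup>2 - 4 * c))"

definition R_plus :: "real \<Rightarrow> real \<Rightarrow> complex" where
  "R_plus b c = (of_real b + sqrt_disc b c) / 2"

definition R_minus :: "real \<Rightarrow> real \<Rightarrow> complex" where
  "R_minus b c = (of_real b - sqrt_disc b c) / 2"

(* The principal logarithm is the branch vanishing at z = 0. The definition is
   meaningful for b^2 \<noteq> 4c only. *)
definition Psi_gen :: "real \<Rightarrow> real \<Rightarrow> real \<Rightarrow> complex \<Rightarrow> complex" where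
  "Psi_gen a b c z =
     of_real a / sqrt_disc b c * Ln ((1 - z * R_minus b c) / (1 - z * R_plus b c))"

definition Psi :: "nat \<Rightarrow> complex \<Rightarrow> real \<Rightarrow> real \<Rightarrow> real \<Rightarrow> complex" where
  "Psi n x a b c = fact n * fps_nth (fps_expansion (\<lambda>z. exp (x * Psi_gen a b c z)) 0) n"

lemma Psi_generating_function:
  assumes "b\<^sup>2 \<noteq> 4 * c"
  shows "(\<lambda>z. exp (x * Psi_gen a b c z)) has_fps_expansion Abs_fps (\<lambda>n. Psi n x a b c / fact n)"
proof -
  have "complex_of_real (b\<^sup>2 - 4 * c) \<noteq> 0"
    using assms by (subst of_real_eq_0_iff) simp
  then have "sqrt_disc b c \<noteq> 0"
    by (simp add: sqrt_disc_def del: of_real_diff)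
  then have "(\<lambda>z. exp (x * Psi_gen a b c z)) analytic_on {0}"
    unfolding Psi_gen_def by (auto intro!: analytic_intros)
  then have "(\<lambda>z. exp (x * Psi_gen a b c z)) has_fps_expansion
      fps_expansion (\<lambda>z. exp (x * Psi_gen a b c z)) 0"
    by (rule analytic_at_imp_has_fps_expansion_0)
  then show ?thesis
    by (simp add: Psi_def fps_nth_inverse)
qed

(* For A = -n with n a natural number the series terminates, so it makes sense for every z. *)
definition hypergeo_2F1 :: "complex \<Rightarrow> complex \<Rightarrow> complex \<Rightarrow> complex \<Rightarrow> complex" where
  "hypergeo_2F1 A B C z = eval_fps (fps_hypergeo [A, B] [C] 1) z"

definition meixner_pollaczek :: "real \<Rightarrow> nat \<Rightarrow> complex \<Rightarrow> real \<Rightarrow> complex" where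
  "meixner_pollaczek lam n x \<phi> =
     pochhammer (2 * of_real lam) n / fact n * exp (\<i> * of_nat n * of_real \<phi>) *
     hypergeo_2F1 (- of_nat n) (of_real lam + \<i> * x) (2 * of_real lam)
       (1 - exp (- 2 * \<i> * of_real \<phi>))"

end

theory Submission
  imports Defs
begin

text \<open>
  Write \<open>p\<close> and \<open>q\<close> for the two values \<open>R\<^sup>\<plusminus>\<close>. Near \<open>0\<close> the generating function is
  \<open>(1 + u) powr e\<close> with \<open>u = (p - q) z / (1 - p z)\<close> and \<open>e = - \<i> y\<close>, where \<open>y\<close> is the argument of
  the Meixner-Pollaczek polynomial. Since the coefficient of \<open>z\<^bsup>n+1\<^esup>\<close> in \<open>u\<^bsup>k+1\<^esup>\<close> is
  \<open>(p - q)\<^bsup>k+1\<^esup> (n choose k) p\<^bsup>n-k\<^esup>\<close>, the coefficients of the composition are terminating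
  hypergeometric sums in \<open>(p - q) / p = 1 - exp (- 2 \<i> \<phi>)\<close>, which agree term by term with the
  ones defining the Meixner-Pollaczek polynomial.
\<close>

lemma hypergeo_2F1_terminating:
  "hypergeo_2F1 (- of_nat n) B C z =
     (\<Sum>k\<le>n. pochhammer (- of_nat n) k * pochhammer B k / (pochhammer C k * fact k) * z ^ k)"
  unfolding hypergeo_2F1_def eval_fps_def
  by (subst suminf_finite[of "{..n}"]) (auto simp: pochhammer_of_nat_eq_0_iff)

text \<open>The signs \<open>(- 1) ^ k\<close> from \<open>pochhammer (- of_nat n) k\<close> and
  from \<open>- B gchoose k\<close> cancel. Since \<open>pochhammer 2 k\<close> is (k+1)!, what
  remains is the absorption rule (k+1) C(n+1,k+1) = (n+1) C(n,k).\<close>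

lemma choose_gbinomial_eq_pochhammer:
  fixes B :: "'a :: field_char_0"
  assumes "k \<le> n"
  shows "of_nat (Suc n) * (pochhammer (- of_nat n) k * pochhammer B k / (pochhammer 2 k * fact k)) =
         of_nat (Suc n choose Suc k) * (- B gchoose k)"
proof -
  have "pochhammer (- of_nat n) k = (- 1) ^ k * fact k * (of_nat (n choose k) :: 'a)"
    by (simp add: binomial_gbinomial gbinomial_pochhammer flip: power_mult_distrib)
  moreover have "pochhammer 2 k = (fact (Suc k) :: 'a)"
    by (simp add: pochhammer_fact pochhammer_rec)
  moreover have "of_nat (Suc k) * of_nat (Suc n choose Suc k) = (of_nat (Suc n) * of_nat (n choose k) :: 'a)"
    unfolding of_nat_mult [symmetric] by (simp only: Suc_times_binomial)
  moreover have "of_nat (Suc k) \<noteq> (0 :: 'a)"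
    by (simp only: of_nat_eq_0_iff)
  ultimately show ?thesis
    by (simp add: gbinomial_pochhammer divide_simps mult.commute[of _ "of_nat (Suc k)"]
        del: of_nat_Suc binomial_Suc_Suc)
qed

text \<open>For \<lambda> = 1 the prefactor \<open>pochhammer 2 n / fact n\<close> is n+1, exactly
  the factor needed to rewrite each hypergeometric term with binomials.\<close>

lemma meixner_pollaczek_1:
  "meixner_pollaczek 1 n y \<phi> = exp (\<i> * of_real \<phi>) ^ n *
     (\<Sum>k\<le>n. of_nat (Suc n choose Suc k) * (- (1 + \<i> * y) gchoose k) *
        (1 - exp (- 2 * \<i> * of_real \<phi>)) ^ k)"
proof -
  have "pochhammer 2 n / fact n = (of_nat (Suc n) :: complex)"
    using pochhammer_rec[of "1 :: complex" n] by (simp add: pochhammer_fact[symmetric] field_simps)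
  then have "meixner_pollaczek 1 n y \<phi> = exp (\<i> * of_real \<phi>) ^ n *
     (\<Sum>k\<le>n. of_nat (Suc n) * (pochhammer (- of_nat n) k * pochhammer (1 + \<i> * y) k /
        (pochhammer 2 k * fact k)) * (1 - exp (- 2 * \<i> * of_real \<phi>)) ^ k)"
    by (simp add: meixner_pollaczek_def hypergeo_2F1_terminating sum_distrib_left mult_ac
          flip: exp_of_nat_mult del: of_nat_Suc)
  also have "\<dots> = exp (\<i> * of_real \<phi>) ^ n *
     (\<Sum>k\<le>n. of_nat (Suc n choose Suc k) * (- (1 + \<i> * y) gchoose k) *
        (1 - exp (- 2 * \<i> * of_real \<phi>)) ^ k)"
  proof -
    have "of_nat (Suc n) * (pochhammer (- of_nat n) k * pochhammer (1 + \<i> * y) k /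
        (pochhammer 2 k * fact k)) = of_nat (Suc n choose Suc k) * (- (1 + \<i> * y) gchoose k)"
      if "k \<in> {..n}" for k
      using that by (intro choose_gbinomial_eq_pochhammer) simp
    then show ?thesis
      by (simp only: cong: sum.cong)
  qed
  finally show ?thesis .
qed

text \<open>For v = p - q this is the expansion of (1 - q z) / (1 - p z) - 1.\<close>

definition moebius_fps :: "'a \<Rightarrow> 'a \<Rightarrow> 'a :: field_char_0 fps" where
  "moebius_fps v p = fps_const v * fps_X * inverse (1 - fps_const p * fps_X)"

lemma moebius_fps_nth_0 [simp]: "moebius_fps v p $ 0 = 0"
  by (simp add: moebius_fps_def)

text \<open>Negative binomial series for the power k+1, shifted by \<open>fps_X ^ Suc k\<close>. For
  k > n both sides vanish, so the truncated \<open>n - k\<close> is harmless.\<close>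

lemma moebius_fps_power_nth_Suc:
  "(moebius_fps v p ^ Suc k) $ Suc n = v ^ Suc k * of_nat (n choose k) * p ^ (n - k)"
proof -
  have "moebius_fps v p ^ Suc k =
      fps_const (v ^ Suc k) * (fps_X ^ Suc k * inverse ((1 - fps_const p * fps_X) ^ Suc k))"
    by (simp only: moebius_fps_def power_mult_distrib fps_const_power fps_inverse_power mult.assoc)
  also have "\<dots> $ Suc n = v ^ Suc k * of_nat (n choose k) * p ^ (n - k)"
    by (subst one_minus_const_fps_X_neg_power')
       (auto simp: fps_X_power_mult_nth binomial_symmetric[of k n] simp del: power_Suc)
  finally show ?thesis .
qed

text \<open>The factor n+1 allows absorption in both kinds of binomial: a common k+1 cancels and e
  comes out of the sum.\<close>

lemma fps_binomial_compose_moebius_nth: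
  "of_nat (Suc n) * (fps_binomial e oo moebius_fps v p) $ Suc n =
     e * v * (\<Sum>k\<le>n. of_nat (Suc n choose Suc k) * ((e - 1) gchoose k) * v ^ k * p ^ (n - k))"
proof -
  have coeff: "of_nat (Suc n) * ((e gchoose Suc k) * of_nat (n choose k)) =
      e * ((e - 1) gchoose k) * of_nat (Suc n choose Suc k)" for k
  proof -
    have "of_nat (Suc k) * (e gchoose Suc k) = e * ((e - 1) gchoose k)"
      by (rule gbinomial_absorption)
    moreover have "of_nat (Suc k) * of_nat (Suc n choose Suc k) =
        (of_nat (Suc n) * of_nat (n choose k) :: 'a)"
      unfolding of_nat_mult [symmetric] by (simp only: Suc_times_binomial)
    ultimately show ?thesis
      by (metis (no_types) mult.assoc mult.commute)
  qed
  have "of_nat (Suc n) * (fps_binomial e oo moebius_fps v p) $ Suc n =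
      (\<Sum>k\<le>n. of_nat (Suc n) * ((e gchoose Suc k) *
        (v ^ Suc k * of_nat (n choose k) * p ^ (n - k))))"
    \<comment> \<open>The term for the power 0 splits off and vanishes, as the constant 1 has no
      coefficient at \<open>Suc n\<close>.\<close>
    unfolding fps_compose_nth fps_binomial_nth atLeast0AtMost sum.atMost_Suc_shift
      moebius_fps_power_nth_Suc
    by (simp add: sum_distrib_left del: of_nat_Suc)
  also have "\<dots> = (\<Sum>k\<le>n. of_nat (Suc n) * ((e gchoose Suc k) * of_nat (n choose k)) *
        (v ^ Suc k * p ^ (n - k)))"
    by (simp only: mult_ac)
  also have "\<dots> = e * v * (\<Sum>k\<le>n. of_nat (Suc n choose Suc k) * ((e - 1) gchoose k) *
        v ^ k * p ^ (n - k))"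
    unfolding coeff by (simp add: sum_distrib_left mult_ac del: binomial_Suc_Suc)
  finally show ?thesis .
qed

lemma has_fps_expansion_exp_Ln_moebius:
  fixes e p q :: complex
  shows "(\<lambda>z. exp (e * Ln ((1 - z * q) / (1 - z * p)))) has_fps_expansion
           (fps_binomial e oo moebius_fps (p - q) p)"
proof -
  define u where "u = (\<lambda>z. (p - q) * z * inverse (1 - p * z))"
  have "u has_fps_expansion moebius_fps (p - q) p"
    unfolding u_def moebius_fps_def by (intro fps_expansion_intros) auto
  then have "((\<lambda>w. (1 + w) powr e) \<circ> u) has_fps_expansion
      (fps_binomial e oo moebius_fps (p - q) p)"
    by (intro has_fps_expansion_compose fps_expansion_intros) auto
  moreover have "eventually (\<lambda>z. exp (e * Ln ((1 - z * q) / (1 - z * p))) =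
      ((\<lambda>w. (1 + w) powr e) \<circ> u) z) (nhds 0)"
  proof -
    \<comment> \<open>Needed with r = p for the division, and with r = q because \<open>powr\<close>
      unfolds to \<open>exp\<close> of \<open>Ln\<close> only at a nonzero base.\<close>
    have nz: "eventually (\<lambda>z. 1 - z * r \<noteq> 0) (nhds 0)" for r :: complex
    proof -
      have "open {z. 1 - z * r \<noteq> 0}"
        by (intro open_Collect_neq continuous_intros)
      then show ?thesis
        using eventually_nhds_in_open[of "{z. 1 - z * r \<noteq> 0}" 0] by simp
    qed
    show ?thesis
      using nz[of p] nz[of q]
    proof eventually_elim
      case (elim z)
      then have "1 + u z = (1 - z * q) / (1 - z * p)"
        by (simp add: u_def divide_simps mult.commute[of z]) (simp add: algebra_simps)
      with elim show ?case
        by (simp add: powr_def)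
    qed
  qed
  ultimately show ?thesis
    by (subst has_fps_expansion_cong) auto
qed

text \<open>The principal root of a negative real lies on the positive imaginary axis, so
  \<open>R_plus\<close> is the value with argument +\<phi>.\<close>

lemma sqrt_disc_neg:
  assumes "b\<^sup>2 - 4 * c < 0"
  shows "sqrt_disc b c = \<i> * of_real (sqrt (4 * c - b\<^sup>2))"
  using assms csqrt_of_real_nonpos[of "b\<^sup>2 - 4 * c"] unfolding sqrt_disc_def by simp

theorem corollary14:
  fixes a b c \<phi> :: real and x :: complex and n :: nat
  assumes "a \<noteq> 0" and "c > 0" and "b\<^sup>2 - 4 * c < 0"
    and "0 < \<phi>" and "\<phi> < pi"
    and "1 / (2 * complex_of_real (sqrt c)) * (of_real b + \<i> * of_real (sqrt (4 * c - b\<^sup>2)))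
           = exp (\<i> * of_real \<phi>)"
    and "1 / (2 * complex_of_real (sqrt c)) * (of_real b - \<i> * of_real (sqrt (4 * c - b\<^sup>2)))
           = exp (- \<i> * of_real \<phi>)"
    and "n \<ge> 1"
  shows "Psi n x a b c =
    fact (n - 1) * of_real (c powr ((real n - 1) / 2)) * of_real a * x *
    meixner_pollaczek 1 (n - 1) (of_real (a / sqrt (4 * c - b\<^sup>2)) * x) \<phi>"
proof -
  obtain m where n: "n = Suc m"
    using assms(8) by (cases n) auto
  define d where "d = sqrt (4 * c - b\<^sup>2)"
  define p q where "p = R_plus b c" and "q = R_minus b c"
  define e where "e = x * of_real a / sqrt_disc b c"
  define y where "y = of_real (a / d) * x"
  define w where "w = 1 - exp (- 2 * \<i> * of_real \<phi>)"
  have s: "sqrt_disc b c = \<i> * of_real d"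
    using sqrt_disc_neg[OF assms(3)] by (simp add: d_def)
  have d: "d > 0"
    using assms(3) by (simp add: d_def)
  have c: "complex_of_real (sqrt c) \<noteq> 0"
    using assms(2) by simp
  have p: "p = of_real (sqrt c) * exp (\<i> * of_real \<phi>)"
    using c unfolding assms(6) [symmetric] by (simp add: p_def R_plus_def s d_def)
  have q: "q = of_real (sqrt c) * exp (- \<i> * of_real \<phi>)"
    using c unfolding assms(7) [symmetric] by (simp add: q_def R_minus_def s d_def)
  have pq: "p - q = p * w"
    by (simp add: p q w_def algebra_simps flip: exp_add)
  have e: "e = - \<i> * y"
    using d by (simp add: e_def s y_def field_simps)
  \<comment> \<open>Here p - q is \<open>sqrt_disc b c\<close>, the denominator of \<open>e\<close>;
    this yields the factor a x of the claim.\<close>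
  have ev: "e * (p - q) = of_real a * x"
    using d by (simp add: e_def p_def q_def R_plus_def R_minus_def s field_simps)
  \<comment> \<open>Splitting (m+1)! as m! (m+1) supplies the factor that the coefficient formula
    requires.\<close>
  have "Psi n x a b c = fact m * (of_nat (Suc m) * (fps_binomial e oo moebius_fps (p - q) p) $ Suc m)"
  proof -
    have "(\<lambda>z. exp (x * Psi_gen a b c z)) = (\<lambda>z. exp (e * Ln ((1 - z * q) / (1 - z * p))))"
      by (simp add: Psi_gen_def e_def p_def q_def mult.assoc)
    then show ?thesis
      using fps_expansion_eqI[OF has_fps_expansion_exp_Ln_moebius[of e q p]]
      by (simp add: Psi_def n mult_ac)
  qed
  also have "of_nat (Suc m) * (fps_binomial e oo moebius_fps (p - q) p) $ Suc m =
      of_real a * x * (\<Sum>k\<le>m. of_nat (Suc m choose Suc k) * ((e - 1) gchoose k) *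
        (p - q) ^ k * p ^ (m - k))"
    unfolding fps_binomial_compose_moebius_nth ev ..
  also have "(\<Sum>k\<le>m. of_nat (Suc m choose Suc k) * ((e - 1) gchoose k) * (p - q) ^ k * p ^ (m - k)) =
      p ^ m * (\<Sum>k\<le>m. of_nat (Suc m choose Suc k) * (- (1 + \<i> * y) gchoose k) * w ^ k)"
    unfolding sum_distrib_left
  proof (rule sum.cong)
    fix k assume "k \<in> {..m}"
    then have "(p - q) ^ k * p ^ (m - k) = p ^ m * w ^ k"
      by (simp add: pq power_mult_distrib mult_ac flip: power_add)
    moreover have "e - 1 = - (1 + \<i> * y)"
      by (simp add: e)
    ultimately show "of_nat (Suc m choose Suc k) * ((e - 1) gchoose k) * (p - q) ^ k * p ^ (m - k) =
        p ^ m * (of_nat (Suc m choose Suc k) * (- (1 + \<i> * y) gchoose k) * w ^ k)"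
      by (simp only: mult.assoc) (simp only: mult_ac)
  qed simp
  also have "\<dots> = of_real (sqrt c) ^ m * meixner_pollaczek 1 m y \<phi>"
    by (simp add: meixner_pollaczek_1 p w_def power_mult_distrib del: binomial_Suc_Suc)
  also have "of_real (sqrt c) ^ m = complex_of_real (c powr ((real n - 1) / 2))"
    using assms(2) by (simp add: n powr_half_sqrt [symmetric] powr_power flip: of_real_power)
  finally show ?thesis
    by (simp add: n y_def d_def mult_ac)
qed

end
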